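(* A locally narrow topological lop $X$ satisfying the separation axiom $T_0$ is a $\mathfrak P_0$-space if and only if $X$ is metrizable and separable.
   Context: "Regular" means $T_3$. A lop is a set $X$ endowed with a binary operation $X\times X\to X$, $(x,y)\mapsto xy$, that has a unit $e\in X$ (i.e. $xe=x=ex$ for all $x\in X$) and such that for every $a\in X$ the left shift $L_a:X\to X$, $L_a(x)=ax$, is bijective (associativity is not assumed). The division operation is $q:X\times X\to X$, $q(x,y)=x^{-1}y:=L_x^{-1}(y)$. A topological lop is a lop endowed with a topology such that both the multiplication $(x,y)\mapsto xy$ and the division $(x,y)\mapsto x^{-1}y$ are continuous as maps $X\times X\to X$. A subset $B$ of a topological lop $X$ is narrow if for any neighborhood $U\subset X$ of the unit $e$, any infinite subset $A\subset B$ contains a point $a\in A$ such that the intersection $A\cap aU$ is infinite. A topological lop $X$ is locally narrow if $X$ contains a narrow neighborhood of the unit $e$. A subset $A$ of a topological space $X$ accumulates at a point $x\in X$ if each neighborhood of $x$ contains infinitely many points of $A$. A family $\mathcal N$ of subsets of $X$ is a network at $x\in X$ if for any neighborhood $O_x$ of $x$ there is $N\in\mathcal N$ with $x\in N\subset O_x$. It is a Pytkeev network at $x$ if it is a network at $x$ and for each neighborhood $O_x$ of $x$ and each subset $A\subset X$ accumulating at $x$ there is $N\in\mathcal N$ such that $N\subset O_x$ and $N\cap A$ is infinite. It is a Pytkeev network for $X$ if it is a Pytkeev network at each point $x\in X$. A $\mathfrak P_0$-space is a regular space with a countable Pytkeev network. *)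

theory Defs
  imports "HOL-Analysis.Analysis"
begin

text \<open>Closure under multiplication is contained in \<open>bij_left_shift\<close>.\<close>

locale lop =
  fixes S :: "'a set" and m :: "'a \<Rightarrow> 'a \<Rightarrow> 'a" and e :: 'a
  assumes unit_closed: "e \<in> S"
    and right_unit: "x \<in> S \<Longrightarrow> m x e = x"
    and left_unit: "x \<in> S \<Longrightarrow> m e x = x"
    and bij_left_shift: "a \<in> S \<Longrightarrow> bij_betw (m a) S S"

definition lop_div :: "'a set \<Rightarrow> ('a \<Rightarrow> 'a \<Rightarrow> 'a) \<Rightarrow> 'a \<Rightarrow> 'a \<Rightarrow> 'a" where
  "lop_div S m x y = inv_into S (m x) y"

locale topological_lop = lop "topspace X" m e
  for X :: "'a topology" and m :: "'a \<Rightarrow> 'a \<Rightarrow> 'a" and e :: 'a +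
  assumes continuous_mult: "continuous_map (prod_topology X X) X (\<lambda>(x, y). m x y)"
    and continuous_div:
      "continuous_map (prod_topology X X) X (\<lambda>(x, y). lop_div (topspace X) m x y)"

text \<open>Neighborhoods need not be open.\<close>

definition neighborhood_in :: "'a topology \<Rightarrow> 'a \<Rightarrow> 'a set \<Rightarrow> bool" where
  "neighborhood_in X x U \<longleftrightarrow> U \<subseteq> topspace X \<and> (\<exists>V. openin X V \<and> x \<in> V \<and> V \<subseteq> U)"

definition narrow :: "'a topology \<Rightarrow> ('a \<Rightarrow> 'a \<Rightarrow> 'a) \<Rightarrow> 'a \<Rightarrow> 'a set \<Rightarrow> bool" where
  "narrow X m e B \<longleftrightarrow> B \<subseteq> topspace X \<and>
     (\<forall>U A. neighborhood_in X e U \<and> A \<subseteq> B \<and> infinite A \<longrightarrow>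
        (\<exists>a\<in>A. infinite (A \<inter> m a ` U)))"

definition locally_narrow :: "'a topology \<Rightarrow> ('a \<Rightarrow> 'a \<Rightarrow> 'a) \<Rightarrow> 'a \<Rightarrow> bool" where
  "locally_narrow X m e \<longleftrightarrow> (\<exists>B. neighborhood_in X e B \<and> narrow X m e B)"

definition accumulates_at :: "'a topology \<Rightarrow> 'a set \<Rightarrow> 'a \<Rightarrow> bool" where
  "accumulates_at X A x \<longleftrightarrow> A \<subseteq> topspace X \<and> x \<in> topspace X \<and>
     (\<forall>U. neighborhood_in X x U \<longrightarrow> infinite (U \<inter> A))"

definition network_at :: "'a topology \<Rightarrow> 'a set set \<Rightarrow> 'a \<Rightarrow> bool" where
  "network_at X \<N> x \<longleftrightarrow> \<N> \<subseteq> Pow (topspace X) \<and>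
     (\<forall>U. neighborhood_in X x U \<longrightarrow> (\<exists>N\<in>\<N>. x \<in> N \<and> N \<subseteq> U))"

definition Pytkeev_network_at :: "'a topology \<Rightarrow> 'a set set \<Rightarrow> 'a \<Rightarrow> bool" where
  "Pytkeev_network_at X \<N> x \<longleftrightarrow> network_at X \<N> x \<and>
     (\<forall>U A. neighborhood_in X x U \<and> accumulates_at X A x \<longrightarrow>
        (\<exists>N\<in>\<N>. N \<subseteq> U \<and> infinite (N \<inter> A)))"

definition Pytkeev_network :: "'a topology \<Rightarrow> 'a set set \<Rightarrow> bool" where
  "Pytkeev_network X \<N> \<longleftrightarrow>
     \<N> \<subseteq> Pow (topspace X) \<and> (\<forall>x\<in>topspace X. Pytkeev_network_at X \<N> x)"

text \<open>Regularity includes the \<open>T\<^sub>1\<close> axiom here, which \<^const>\<open>regular_space\<close> does not.\<close>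

definition P0_space :: "'a topology \<Rightarrow> bool" where
  "P0_space X \<longleftrightarrow> regular_space X \<and> t1_space X \<and> (\<exists>\<N>. countable \<N> \<and> Pytkeev_network X \<N>)"

end

theory Submission
  imports Defs
begin

text \<open>
  A separable metrizable space has a countable base, and any base is a Pytkeev network. The content
  is the other implication. A countable network already makes \<open>X\<close> separable, so by Urysohn's
  metrization theorem it is enough to find a countable base. Left shifts are homeomorphisms, and they
  spread a countable base at the unit \<open>e\<close> over the points of a countable dense set; so only a
  countable base at \<open>e\<close> has to be found.

  Let \<open>B\<close> be a narrow neighborhood of \<open>e\<close>, let \<open>\<N>\<close> be a countable Pytkeev network at \<open>e\<close>, and let
  \<open>V\<close> be a neighborhood of \<open>e\<close>. The key fact, \<open>narrow_finite_cover\<close>, is that \<open>B\<close> is covered by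
  finitely many left shifts of some finite union \<open>F\<close> of members of \<open>\<N>\<close> contained in \<open>V\<close>. Otherwise,
  with \<open>F\<^sub>j\<close> increasing finite unions that exhaust the members of \<open>\<N>\<close> inside \<open>V\<close>, one can choose points
  \<open>a\<^sub>j \<in> B\<close> one after another, outside all the sets \<open>a\<^sub>iF\<^sub>j\<close> with \<open>i < j\<close>. By narrowness the
  quotients \<open>a\<^sub>i\<^sup>-\<^sup>1a\<^sub>j\<close> with \<open>i < j\<close> accumulate at \<open>e\<close>; but \<open>a\<^sub>i\<^sup>-\<^sup>1a\<^sub>j \<notin> F\<^sub>j\<close>, so each member of \<open>\<N>\<close>
  inside \<open>V\<close> contains only finitely many of them, against the Pytkeev property.

  If \<open>V\<close> is closed, the closure of \<open>F\<close> stays in \<open>V\<close>. A finite union of closed sets that has an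
  interior point has a member with an interior point, so the closure of \<open>F\<close> has nonempty interior \<open>G\<close>,
  and \<open>x\<^sup>-\<^sup>1G\<close> is an open neighborhood of \<open>e\<close> inside \<open>V\<^sup>-\<^sup>1V\<close> for every \<open>x \<in> G\<close>. Taking \<open>x\<close> from a
  countable dense set leaves countably many sets \<open>x\<^sup>-\<^sup>1G\<close>, and they form a base at \<open>e\<close>.
\<close>

section \<open>Metrizability and countable bases\<close>

text \<open>The diagonal map into the countable power \<open>\<real>\<^sup>I\<close> is an embedding: the functions separate
  points from closed sets, which makes it open onto its image and, as points are closed, injective.\<close>

lemma metrizable_space_if_countable_separating_functions:
  fixes f :: "'i \<Rightarrow> 'a \<Rightarrow> real"
  assumes "t1_space X" "countable I"
    and cont: "\<And>i. i \<in> I \<Longrightarrow> continuous_map X euclideanreal (f i)"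
    and sep: "\<And>U x. openin X U \<Longrightarrow> x \<in> U \<Longrightarrow>
      \<exists>i\<in>I. f i x = 0 \<and> (\<forall>y\<in>topspace X - U. f i y = 1)"
  shows "metrizable_space X"
proof -
  let ?Y = "powertop_real I"
  define h where "h x = (\<lambda>i\<in>I. f i x)" for x
  let ?Z = "subtopology ?Y (h ` topspace X)"
  have "h ` topspace X \<subseteq> topspace ?Y"
    by (auto simp: h_def)
  then have Z: "topspace ?Z = h ` topspace X"
    by auto
  have "continuous_map X ?Y h"
    using cont by (auto simp: continuous_map_componentwise h_def)
  then have conth: "continuous_map X ?Z h"
    by (simp add: continuous_map_in_subtopology)
  have inj: "inj_on h (topspace X)"
  proof (rule inj_onI, rule ccontr)
    fix x y assume xy: "x \<in> topspace X" "y \<in> topspace X" "h x = h y" "x \<noteq> y"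
    then obtain U where U: "openin X U" "x \<in> U" "y \<notin> U"
      using \<open>t1_space X\<close> unfolding t1_space_def by meson
    then obtain i where i: "i \<in> I" "f i x = 0" "f i y = 1"
      using sep[OF U(1,2)] xy by blast
    then have "h x i \<noteq> h y i"
      by (simp add: h_def)
    with xy show False by simp
  qed
  have "open_map X ?Z h"
    unfolding open_map_def
  proof (intro allI impI)
    fix U assume U: "openin X U"
    show "openin ?Z (h ` U)"
    proof (rule openin_subopen[THEN iffD2], intro ballI)
      fix z assume "z \<in> h ` U"
      then obtain x where x: "x \<in> U" "z = h x" by blast
      obtain i where i: "i \<in> I" "f i x = 0" "\<And>y. y \<in> topspace X - U \<Longrightarrow> f i y = 1"
        using sep[OF U x(1)] by blast
      (* The image of x is separated from the image of the complement of U by the i-th coordinate. *)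
      let ?W = "{w \<in> topspace ?Y. w i \<in> {..<1}}"
      have "openin ?Y ?W"
        using i(1) by (intro openin_continuous_map_preimage[where Y = euclideanreal])
          (auto intro: continuous_map_product_projection)
      then have "openin ?Z (?W \<inter> h ` topspace X)"
        by (rule openin_subtopology_Int)
      moreover have "z \<in> ?W \<inter> h ` topspace X"
        using x i openin_subset[OF U] by (auto simp: h_def)
      moreover have "?W \<inter> h ` topspace X \<subseteq> h ` U"
      proof
        fix w assume "w \<in> ?W \<inter> h ` topspace X"
        then obtain y where y: "y \<in> topspace X" "w = h y" "w i < 1" by blast
        then have "y \<in> U" using i(1) i(3)[of y] by (cases "y \<in> U") (auto simp: h_def)
        with y show "w \<in> h ` U" by blast
      qed
      ultimately show "\<exists>T. openin ?Z T \<and> z \<in> T \<and> T \<subseteq> h ` U" by blast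
    qed
  qed
  then have "homeomorphic_map X ?Z h"
    using conth inj Z by (intro bijective_open_imp_homeomorphic_map) auto
  moreover have "metrizable_space ?Z"
    using \<open>countable I\<close>
    by (intro metrizable_space_subtopology)
       (auto simp: metrizable_space_product_topology metrizable_space_euclidean)
  ultimately show ?thesis
    using homeomorphic_map_imp_homeomorphic_space homeomorphic_metrizable_space by blast
qed

text \<open>For a countable base \<open>\<B>\<close> the pairs \<open>(U, V)\<close> in \<open>\<B>\<close> with the closure of \<open>U\<close> inside \<open>V\<close> are
  countably many, and the Urysohn functions of these pairs separate points from closed sets by
  regularity.\<close>

lemma Urysohn_metrization:
  assumes "regular_space X" "t1_space X" "second_countable X"
  shows "metrizable_space X"
proof -
  obtain \<B> where \<B>: "countable \<B>" "\<And>V. V \<in> \<B> \<Longrightarrow> openin X V"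
    "\<And>U x. openin X U \<Longrightarrow> x \<in> U \<Longrightarrow> \<exists>V\<in>\<B>. x \<in> V \<and> V \<subseteq> U"
    using assms(3) unfolding second_countable_def by meson
  have normal: "normal_space X"
    using assms by (simp add: regular_Lindelof_imp_normal_space second_countable_imp_Lindelof_space)
  define I where "I = {(U, V) \<in> \<B> \<times> \<B>. X closure_of U \<subseteq> V}"
  have "\<exists>f. continuous_map X euclideanreal f \<and> (\<forall>x\<in>U. f x = 0) \<and> (\<forall>x\<in>topspace X - V. f x = 1)"
    if "(U, V) \<in> I" for U V
  proof -
    have UV: "openin X U" "openin X V" "X closure_of U \<subseteq> V"
      using that \<B> by (auto simp: I_def)
    then obtain f where f: "continuous_map X euclideanreal f" "f ` (X closure_of U) \<subseteq> {0}"
        "f ` (topspace X - V) \<subseteq> {1::real}"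
      by (rule_tac Urysohn_lemma_alt[OF normal, of "X closure_of U" "topspace X - V" 0 1])
         (auto simp: disjnt_def)
    moreover have "U \<subseteq> X closure_of U"
      using UV by (simp add: closure_of_subset openin_subset)
    ultimately show ?thesis by blast
  qed
  then obtain f where f: "\<And>i. i \<in> I \<Longrightarrow> continuous_map X euclideanreal (f i)"
      "\<And>U V x. (U, V) \<in> I \<Longrightarrow> x \<in> U \<Longrightarrow> f (U, V) x = (0::real)"
      "\<And>U V x. (U, V) \<in> I \<Longrightarrow> x \<in> topspace X - V \<Longrightarrow> f (U, V) x = 1"
    using bchoice[of I "\<lambda>i f. continuous_map X euclideanreal f \<and> (\<forall>x\<in>fst i. f x = (0::real)) \<and>
      (\<forall>x\<in>topspace X - snd i. f x = 1)"] by force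
  show ?thesis
  proof (rule metrizable_space_if_countable_separating_functions)
    show "countable I"
      using \<B>(1) by (auto simp: I_def intro: countable_subset[of _ "\<B> \<times> \<B>"])
    fix U x assume "openin X U" "x \<in> U"
    then obtain V where V: "V \<in> \<B>" "x \<in> V" "V \<subseteq> U"
      using \<B>(3) by blast
    obtain W C where "openin X W" "closedin X C" "x \<in> W" "W \<subseteq> C" "C \<subseteq> V"
      using assms(1) V \<B>(2) unfolding neighbourhood_base_of_closedin[symmetric] neighbourhood_base_of
      by meson
    moreover obtain W' where W': "W' \<in> \<B>" "x \<in> W'" "W' \<subseteq> W"
      using \<B>(3) calculation by blast
    ultimately have "X closure_of W' \<subseteq> V"
      by (meson closure_of_minimal order_trans)
    then have "(W', V) \<in> I"
      using V W' by (simp add: I_def)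
    moreover from this have "f (W', V) x = 0"
      using W'(2) by (rule f(2))
    moreover have "f (W', V) y = 1" if "y \<in> topspace X - U" for y
      using that V(3) \<open>(W', V) \<in> I\<close> by (intro f(3)) auto
    ultimately show "\<exists>i\<in>I. f i x = 0 \<and> (\<forall>y\<in>topspace X - U. f i y = 1)" by blast
  qed (use assms f in auto)
qed

lemma metrizable_separable_imp_second_countable:
  assumes "metrizable_space X" "separable_space X"
  shows "second_countable X"
proof -
  obtain M d where "Metric_space M d" and X: "X = Metric_space.mtopology M d"
    using assms(1) unfolding metrizable_space_def by blast
  then interpret Metric_space M d by simp
  obtain C where C: "countable C" "C \<subseteq> M" "mtopology closure_of C = M"
    using assms(2) unfolding separable_space_def X by auto
  define \<B> where "\<B> = (\<lambda>(c, n). mball c (1 / Suc n)) ` (C \<times> (UNIV :: nat set))"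
  show ?thesis
    unfolding second_countable_def
  proof (intro exI conjI allI impI ballI)
    show "countable \<B>"
      using C(1) by (simp add: \<B>_def)
    show "openin X V" if "V \<in> \<B>" for V
      using that by (auto simp: \<B>_def X)
    fix U x assume "openin X U \<and> x \<in> U"
    then obtain r where r: "r > 0" "mball x r \<subseteq> U" and x: "x \<in> M"
      unfolding X openin_mtopology by blast
    obtain n where n: "1 / Suc n < r / 2"
      using r(1) by (meson half_gt_zero nat_approx_posE)
    have "x \<in> mtopology closure_of C"
      using C x by simp
    then have "\<forall>\<epsilon>>0. \<exists>c\<in>C. c \<in> mball x \<epsilon>"
      unfolding metric_closure_of by blast
    moreover have "0 < 1 / real (Suc n)"
      by simp
    ultimately obtain c where "c \<in> C" "c \<in> mball x (1 / Suc n)"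
      by blast
    then have c: "c \<in> C" "d x c < 1 / Suc n"
      by auto
    have "mball c (1 / Suc n) \<subseteq> mball x r"
    proof
      fix y assume y: "y \<in> mball c (1 / Suc n)"
      then have "d x y \<le> d x c + d c y"
        using x by (intro triangle) auto
      also have "\<dots> < r"
        using y c(2) n by (simp del: of_nat_Suc)
      finally show "y \<in> mball x r"
        using x y by simp
    qed
    moreover have "x \<in> mball c (1 / Suc n)"
      using c x C(2) by (auto simp: commute simp del: of_nat_Suc)
    ultimately show "\<exists>V\<in>\<B>. x \<in> V \<and> V \<subseteq> U"
      using c(1) r(2) unfolding \<B>_def by (intro bexI[of _ "mball c (1 / Suc n)"]) auto
  qed
qed

section \<open>Countable networks\<close>

text \<open>Members of a base are neighborhoods of their points, so each of them meets a set accumulating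
  at one of its points in infinitely many points.\<close>

lemma second_countable_imp_countable_Pytkeev_network:
  assumes "second_countable X"
  shows "\<exists>\<N>. countable \<N> \<and> Pytkeev_network X \<N>"
proof -
  obtain \<B> where \<B>: "countable \<B>" "\<And>V. V \<in> \<B> \<Longrightarrow> openin X V"
    "\<And>U x. openin X U \<Longrightarrow> x \<in> U \<Longrightarrow> \<exists>V\<in>\<B>. x \<in> V \<and> V \<subseteq> U"
    using assms unfolding second_countable_def by meson
  have base: "\<exists>N\<in>\<B>. x \<in> N \<and> N \<subseteq> U" if "neighborhood_in X x U" for x U
    using that \<B>(3) unfolding neighborhood_in_def by (meson order_trans)
  have sub: "\<B> \<subseteq> Pow (topspace X)"
    using \<B>(2) openin_subset by blast
  have "neighborhood_in X x N" if "N \<in> \<B>" "x \<in> N" for x N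
    using that \<B>(2) openin_subset unfolding neighborhood_in_def by blast
  then have "Pytkeev_network X \<B>"
    unfolding Pytkeev_network_def Pytkeev_network_at_def network_at_def accumulates_at_def
    using base sub by meson
  with \<B>(1) show ?thesis by blast
qed

lemma countable_network_imp_separable:
  assumes "countable \<N>" "\<And>x. x \<in> topspace X \<Longrightarrow> network_at X \<N> x"
  shows "separable_space X"
proof -
  define C where "C = (\<lambda>N. SOME c. c \<in> N) ` {N \<in> \<N>. N \<noteq> {} \<and> N \<subseteq> topspace X}"
  have "countable C"
    using assms(1) by (simp add: C_def)
  moreover have "C \<subseteq> topspace X"
    unfolding C_def using some_in_eq by blast
  moreover have "x \<in> X closure_of C" if x: "x \<in> topspace X" for x
    unfolding in_closure_of
  proof (intro conjI allI impI x)
    fix T assume T: "x \<in> T \<and> openin X T"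
    then have "neighborhood_in X x T"
      using openin_subset unfolding neighborhood_in_def by blast
    then obtain N where N: "N \<in> \<N>" "x \<in> N" "N \<subseteq> T"
      using assms(2)[OF x] unfolding network_at_def by blast
    then have "(SOME c. c \<in> N) \<in> N"
      by (metis someI_ex)
    moreover have "(SOME c. c \<in> N) \<in> C"
      unfolding C_def using N T openin_subset by (intro imageI) blast
    ultimately show "\<exists>y. y \<in> C \<and> y \<in> T"
      using N by blast
  qed
  ultimately show ?thesis
    unfolding separable_space_def using closure_of_subset_topspace by (metis subset_antisym subsetI)
qed

section \<open>Left shifts and left division\<close>

context topological_lop
begin

abbreviation ldiv :: "'a \<Rightarrow> 'a \<Rightarrow> 'a" where
  "ldiv \<equiv> lop_div (topspace X) m"

lemma mult_closed: "a \<in> topspace X \<Longrightarrow> x \<in> topspace X \<Longrightarrow> m a x \<in> topspace X"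
  using bij_left_shift[of a] bij_betwE by blast

lemma ldiv_closed: "a \<in> topspace X \<Longrightarrow> x \<in> topspace X \<Longrightarrow> ldiv a x \<in> topspace X"
  unfolding lop_div_def using bij_left_shift[of a] bij_betw_def by (metis inv_into_into)

lemma mult_ldiv: "a \<in> topspace X \<Longrightarrow> x \<in> topspace X \<Longrightarrow> m a (ldiv a x) = x"
  unfolding lop_div_def using bij_left_shift[of a] bij_betw_inv_into_right by fast

lemma ldiv_mult: "a \<in> topspace X \<Longrightarrow> x \<in> topspace X \<Longrightarrow> ldiv a (m a x) = x"
  unfolding lop_div_def using bij_left_shift[of a] bij_betw_inv_into_left by fast

lemma ldiv_self: "a \<in> topspace X \<Longrightarrow> ldiv a a = e"
  using ldiv_mult[OF _ unit_closed, of a] right_unit by simp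

lemma homeomorphic_map_left_shift:
  assumes "a \<in> topspace X"
  shows "homeomorphic_map X X (m a)"
proof -
  have pair: "continuous_map X (prod_topology X X) (\<lambda>x. (a, x))"
    using assms by (intro continuous_map_pairedI) auto
  have "continuous_map X X (m a)" "continuous_map X X (ldiv a)"
    using continuous_map_compose[OF pair continuous_mult]
      continuous_map_compose[OF pair continuous_div] by (simp_all add: o_def)
  then have "homeomorphic_maps X X (m a) (ldiv a)"
    using assms by (simp add: homeomorphic_maps_def mult_ldiv ldiv_mult)
  then show ?thesis
    using homeomorphic_maps_map by blast
qed

section \<open>Narrow sets and Pytkeev networks\<close>

text \<open>This is where narrowness and the Pytkeev property meet. A narrow set without such a finite
  cover contains a sequence whose quotients accumulate at \<open>e\<close> although each member of the network
  inside \<open>V\<close> contains only finitely many of them.\<close>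

lemma narrow_finite_cover:
  assumes narrow: "narrow X m e B" and pyt: "Pytkeev_network_at X \<N> e" and "countable \<N>"
    and V: "neighborhood_in X e V"
  obtains A \<F> where "finite A" "A \<subseteq> B" "finite \<F>" "\<F> \<subseteq> \<N>" "\<Union>\<F> \<subseteq> V"
    "B \<subseteq> (\<Union>a\<in>A. m a ` \<Union>\<F>)"
proof (rule ccontr)
  assume contra: "\<not> thesis"
  have BX: "B \<subseteq> topspace X"
    using narrow by (simp add: narrow_def)
  have net: "network_at X \<N> e"
    using pyt by (simp add: Pytkeev_network_at_def)
  obtain N0 where N0: "N0 \<in> \<N>" "e \<in> N0" "N0 \<subseteq> V"
    using net V unfolding network_at_def by blast
  define \<M> where "\<M> = {N \<in> \<N>. N \<subseteq> V}"
  have \<M>: "\<M> \<noteq> {}" "countable \<M>"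
    using N0 \<open>countable \<N>\<close> by (auto simp: \<M>_def)
  (* N0 puts e into every union, which makes the terms of the sequence below distinct. *)
  define \<F> where "\<F> j = insert N0 (from_nat_into \<M> ` {..j})" for j
  have \<F>: "finite (\<F> j)" "\<F> j \<subseteq> \<N>" "\<Union>(\<F> j) \<subseteq> V" for j
    using N0 from_nat_into[OF \<M>(1)] by (auto simp: \<F>_def \<M>_def)
  have "\<exists>a. \<forall>j. a j \<in> B \<and> (\<forall>i<j. a j \<notin> m (a i) ` \<Union>(\<F> j))"
  proof (rule dependent_wellorder_choice)
    fix j :: nat and a
    assume "\<And>i. i < j \<Longrightarrow> a i \<in> B \<and> (\<forall>k<i. a i \<notin> m (a k) ` \<Union>(\<F> i))"
    then have "a ` {..<j} \<subseteq> B" by blast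
    then have "\<not> B \<subseteq> (\<Union>x\<in>a ` {..<j}. m x ` \<Union>(\<F> j))"
      using contra that[of "a ` {..<j}" "\<F> j"] \<F> by blast
    then obtain r where "r \<in> B" "r \<notin> (\<Union>x\<in>a ` {..<j}. m x ` \<Union>(\<F> j))"
      by (meson subsetI)
    then show "\<exists>r. r \<in> B \<and> (\<forall>i<j. r \<notin> m (a i) ` \<Union>(\<F> j))" by auto
  qed simp
  then obtain a where aB: "\<And>j. a j \<in> B" and
    new: "\<And>i j. i < j \<Longrightarrow> a j \<notin> m (a i) ` \<Union>(\<F> j)" by blast
  have aX: "a j \<in> topspace X" for j
    using aB BX by blast
  have "a i \<noteq> a j" if "i < j" for i j
  proof
    assume "a i = a j"
    then have "a j = m (a i) e"
      using aX right_unit by metis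
    moreover have "e \<in> \<Union>(\<F> j)"
      using N0 by (simp add: \<F>_def)
    ultimately show False
      using new[OF that] by blast
  qed
  then have inja: "inj a"
    by (metis injI nat_neq_iff)
  define D where "D = {ldiv (a i) (a j) | i j. i < j}"
  have "accumulates_at X D e"
    unfolding accumulates_at_def
  proof (intro conjI allI impI unit_closed)
    show "D \<subseteq> topspace X"
      using ldiv_closed aX by (auto simp: D_def)
    fix U assume U: "neighborhood_in X e U"
    then have UX: "U \<subseteq> topspace X" by (simp add: neighborhood_in_def)
    have "infinite (range a)"
      using inja by (rule range_inj_infinite)
    moreover have "range a \<subseteq> B"
      using aB by blast
    ultimately have "\<exists>x\<in>range a. infinite (range a \<inter> m x ` U)"
      using narrow U unfolding narrow_def by blast
    then obtain i where i: "infinite (range a \<inter> m (a i) ` U)"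
      by blast
    (* Only quotients of a term by an earlier one belong to D, so the first terms are discarded. *)
    have "infinite (range a \<inter> m (a i) ` U - a ` {..i})"
      using i by simp
    moreover have "ldiv (a i) ` (range a \<inter> m (a i) ` U - a ` {..i}) \<subseteq> U \<inter> D"
    proof (rule image_subsetI)
      fix x assume "x \<in> range a \<inter> m (a i) ` U - a ` {..i}"
      then obtain j u where x: "x = a j" "x = m (a i) u" and "u \<in> U" and j: "x \<notin> a ` {..i}"
        by (elim DiffE IntE rangeE imageE)
      then have "m (a i) u = a j"
        by simp
      then have "ldiv (a i) (a j) = u"
        using ldiv_mult[OF aX, of u i] UX \<open>u \<in> U\<close> by auto
      moreover have "i < j"
        using j x by (metis atMost_iff imageI not_le)
      ultimately show "ldiv (a i) x \<in> U \<inter> D"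
        using \<open>u \<in> U\<close> x by (auto simp: D_def)
    qed
    moreover have "inj_on (ldiv (a i)) (range a \<inter> m (a i) ` U - a ` {..i})"
      using aX by (intro inj_on_inverseI[of _ "m (a i)"] mult_ldiv) auto
    ultimately show "infinite (U \<inter> D)"
      by (meson finite_subset finite_imageD)
  qed
  then obtain N where N: "N \<in> \<N>" "N \<subseteq> V" "infinite (N \<inter> D)"
    using pyt V unfolding Pytkeev_network_at_def by blast
  then obtain k where k: "N = from_nat_into \<M> k"
    using from_nat_into_surj[OF \<M>(2), of N] by (auto simp: \<M>_def)
  (* From index k on, the unions contain N, so the choice of the a j keeps their quotients out of N. *)
  have "N \<inter> D \<subseteq> (\<lambda>(i, j). ldiv (a i) (a j)) ` ({..k} \<times> {..k})"
  proof
    fix x assume x: "x \<in> N \<inter> D"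
    then obtain i j where ij: "i < j" "x = ldiv (a i) (a j)"
      by (auto simp: D_def)
    have "j < k"
    proof (rule ccontr)
      assume "\<not> j < k"
      then have "x \<in> \<Union>(\<F> j)"
        using x k by (auto simp: \<F>_def)
      moreover have "a j = m (a i) x"
        using ij aX by (simp add: mult_ldiv)
      ultimately show False
        using new[OF ij(1)] by blast
    qed
    with ij show "x \<in> (\<lambda>(i, j). ldiv (a i) (a j)) ` ({..k} \<times> {..k})" by force
  qed
  then show False
    using N(3) by (meson finite_SigmaI finite_atMost finite_imageI finite_subset)
qed

end

section \<open>From the unit to the whole lop\<close>

text \<open>A Baire property of finite unions, valid in every space: if the open set is not inside the first
  closed set, its part outside that set is open, nonempty, and covered by the others.\<close>

lemma finite_Union_closed_interior:
  assumes "finite \<C>" "\<And>C. C \<in> \<C> \<Longrightarrow> closedin X C" "openin X W" "W \<noteq> {}" "W \<subseteq> \<Union>\<C>"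
  shows "\<exists>C\<in>\<C>. X interior_of C \<noteq> {}"
  using assms
proof (induction \<C> arbitrary: W rule: finite_induct)
  case (insert C \<C>)
  show ?case
  proof (cases "W \<subseteq> C")
    case True
    then show ?thesis
      using insert.prems interior_of_maximal by blast
  next
    case False
    have "openin X (W - C)"
      using insert.prems by (simp add: openin_diff)
    then show ?thesis
      using insert.IH[of "W - C"] insert.prems False by blast
  qed
qed auto

context topological_lop
begin

text \<open>Continuity of the division at \<open>(e, e)\<close>, as \<open>e\<^sup>-\<^sup>1e = e\<close>.\<close>

lemma exists_open_ldiv_subset:
  assumes "openin X U" "e \<in> U"
  obtains V where "openin X V" "e \<in> V" "\<And>x y. x \<in> V \<Longrightarrow> y \<in> V \<Longrightarrow> ldiv x y \<in> U"
proof -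
  let ?P = "{p \<in> topspace (prod_topology X X). (\<lambda>(x, y). ldiv x y) p \<in> U}"
  have "openin (prod_topology X X) ?P"
    using continuous_div assms(1) by (rule openin_continuous_map_preimage)
  moreover have "(e, e) \<in> ?P"
    using assms unit_closed ldiv_self by simp
  ultimately obtain V W where VW: "openin X V" "openin X W" "e \<in> V" "e \<in> W" "V \<times> W \<subseteq> ?P"
    unfolding openin_prod_topology_alt by meson
  show thesis
  proof (rule that[of "V \<inter> W"])
    show "ldiv x y \<in> U" if "x \<in> V \<inter> W" "y \<in> V \<inter> W" for x y
    proof -
      have "(x, y) \<in> ?P"
        using VW(5) that by (intro subsetD[of "V \<times> W" ?P]) auto
      then show ?thesis by simp
    qed
  qed (use VW in auto)
qed

text \<open>The base consists of the sets \<open>x\<^sup>-\<^sup>1G\<close>, where \<open>x\<close> runs through a countable dense set and \<open>G\<close>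
  through the interiors of the closures of finite unions of members of \<open>\<N>\<close>.\<close>

lemma countable_base_at_unit:
  assumes "regular_space X" "separable_space X" "locally_narrow X m e"
    and "countable \<N>" "Pytkeev_network_at X \<N> e"
  obtains \<B> where "countable \<B>" "\<And>W. W \<in> \<B> \<Longrightarrow> openin X W"
    "\<And>U. openin X U \<Longrightarrow> e \<in> U \<Longrightarrow> \<exists>W\<in>\<B>. e \<in> W \<and> W \<subseteq> U"
proof -
  obtain S where S: "countable S" "S \<subseteq> topspace X" "X closure_of S = topspace X"
    using assms(2) unfolding separable_space_def by blast
  obtain B where B: "neighborhood_in X e B" "narrow X m e B"
    using assms(3) unfolding locally_narrow_def by blast
  define G where "G \<F> = X interior_of (X closure_of \<Union>\<F>)" for \<F>
  define \<B> where "\<B> = (\<lambda>(x, \<F>). {y \<in> topspace X. m x y \<in> G \<F>}) `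
    (S \<times> {\<F>. finite \<F> \<and> \<F> \<subseteq> \<N>})"
  show thesis
  proof
    show "countable \<B>"
      using S(1) countable_Collect_finite_subset[OF assms(4)] unfolding \<B>_def by blast
    show "openin X W" if W: "W \<in> \<B>" for W
    proof -
      obtain x \<F> where x: "x \<in> S" "W = {y \<in> topspace X. m x y \<in> G \<F>}"
        using W by (auto simp: \<B>_def)
      have "continuous_map X X (m x)"
        using x(1) S(2) homeomorphic_imp_continuous_map homeomorphic_map_left_shift by blast
      moreover have "openin X (G \<F>)"
        by (simp add: G_def)
      ultimately show ?thesis
        unfolding x(2) by (rule openin_continuous_map_preimage)
    qed
    fix U assume "openin X U" "e \<in> U"
    then obtain V where V: "openin X V" "e \<in> V" "\<And>x y. x \<in> V \<Longrightarrow> y \<in> V \<Longrightarrow> ldiv x y \<in> U"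
      using exists_open_ldiv_subset by blast
    then obtain V' C where C: "openin X V'" "closedin X C" "e \<in> V'" "V' \<subseteq> C" "C \<subseteq> V"
      using assms(1) unfolding neighbourhood_base_of_closedin[symmetric] neighbourhood_base_of
      by meson
    then have "neighborhood_in X e C"
      using closedin_subset unfolding neighborhood_in_def by blast
    then obtain A \<F> where A: "finite A" "A \<subseteq> B" "finite \<F>" "\<F> \<subseteq> \<N>" "\<Union>\<F> \<subseteq> C"
      and cover: "B \<subseteq> (\<Union>a\<in>A. m a ` \<Union>\<F>)"
      using narrow_finite_cover[OF B(2) assms(5,4)] by metis
    have BX: "B \<subseteq> topspace X" using B by (simp add: narrow_def)
    let ?K = "X closure_of \<Union>\<F>"
    have KC: "?K \<subseteq> C"
      using A(5) C(2) by (simp add: closure_of_minimal)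
    have FX: "\<Union>\<F> \<subseteq> topspace X"
      using A(5) closedin_subset[OF C(2)] by blast
    have FK: "\<Union>\<F> \<subseteq> ?K"
      using FX by (rule closure_of_subset)
    obtain W where W: "openin X W" "e \<in> W" "W \<subseteq> B"
      using B(1) unfolding neighborhood_in_def by blast
    (* One of the closed shifts of the closure covering W has an interior point, hence so has the closure. *)
    have "\<exists>L\<in>(\<lambda>a. m a ` ?K) ` A. X interior_of L \<noteq> {}"
    proof (rule finite_Union_closed_interior)
      show "closedin X L" if L: "L \<in> (\<lambda>a. m a ` ?K) ` A" for L
      proof -
        obtain a where "a \<in> topspace X" "L = m a ` ?K"
          using L A(2) BX by blast
        then show ?thesis
          using homeomorphic_map_closedness_eq[OF homeomorphic_map_left_shift, of a ?K]
            closedin_closure_of by blast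
      qed
      show "W \<subseteq> \<Union> ((\<lambda>a. m a ` ?K) ` A)"
      proof -
        have "(\<Union>a\<in>A. m a ` \<Union>\<F>) \<subseteq> (\<Union>a\<in>A. m a ` ?K)"
          by (intro UN_mono image_mono FK order_refl)
        with W(3) cover show ?thesis by (meson order_trans)
      qed
    qed (use A W in auto)
    then obtain a where a: "a \<in> A" "X interior_of (m a ` ?K) \<noteq> {}" by blast
    then have "m a ` (X interior_of ?K) \<noteq> {}"
      using homeomorphic_map_interior_of[OF homeomorphic_map_left_shift, of a ?K] A(2) BX
        closure_of_subset_topspace[of X "\<Union>\<F>"] by blast
    then have "G \<F> \<noteq> {}" by (auto simp: G_def)
    then obtain x where x: "x \<in> S" "x \<in> G \<F>"
    proof -
      obtain z where z: "z \<in> G \<F>"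
        using \<open>G \<F> \<noteq> {}\<close> by blast
      have "openin X (G \<F>)"
        by (simp add: G_def)
      moreover from this have "z \<in> X closure_of S"
        using z S(3) openin_subset by blast
      ultimately show thesis
        using z that unfolding in_closure_of by blast
    qed
    have GV: "G \<F> \<subseteq> V"
      using interior_of_subset[of X ?K] KC C(5) unfolding G_def by blast
    have xX: "x \<in> topspace X"
      using x S by blast
    have "{y \<in> topspace X. m x y \<in> G \<F>} \<subseteq> U"
    proof clarify
      fix y assume "y \<in> topspace X" "m x y \<in> G \<F>"
      then show "y \<in> U"
        using V(3)[of x "m x y"] x(2) GV xX by (auto simp: ldiv_mult)
    qed
    moreover have "e \<in> {y \<in> topspace X. m x y \<in> G \<F>}"
      using x xX unit_closed right_unit by simp
    moreover have "{y \<in> topspace X. m x y \<in> G \<F>} \<in> \<B>"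
      using x(1) A unfolding \<B>_def by blast
    ultimately show "\<exists>W\<in>\<B>. e \<in> W \<and> W \<subseteq> U"
      by (intro bexI[of _ "{y \<in> topspace X. m x y \<in> G \<F>}"] conjI)
  qed
qed

text \<open>The shifts \<open>sW\<close> of the base at \<open>e\<close> by the elements \<open>s\<close> of a dense set form a base of \<open>X\<close>: given
  \<open>x\<close>, continuity of \<open>s \<mapsto> s\<^sup>-\<^sup>1x\<close> at \<open>s = x\<close>, where its value is \<open>e\<close>, gives \<open>x \<in> sW\<close> for all \<open>s\<close> near
  \<open>x\<close>, and continuity of the multiplication at \<open>(x, e)\<close> keeps \<open>sW\<close> small.\<close>

lemma second_countable_if_base_at_unit:
  assumes "separable_space X" "countable \<B>" "\<And>W. W \<in> \<B> \<Longrightarrow> openin X W"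
    and base: "\<And>U. openin X U \<Longrightarrow> e \<in> U \<Longrightarrow> \<exists>W\<in>\<B>. e \<in> W \<and> W \<subseteq> U"
  shows "second_countable X"
proof -
  obtain S where S: "countable S" "S \<subseteq> topspace X" "X closure_of S = topspace X"
    using assms(1) unfolding separable_space_def by blast
  show ?thesis
    unfolding second_countable_def
  proof (intro exI[of _ "(\<lambda>(s, W). m s ` W) ` (S \<times> \<B>)"] conjI allI impI ballI)
    show "countable ((\<lambda>(s, W). m s ` W) ` (S \<times> \<B>))"
      using S(1) assms(2) by blast
    show "openin X T" if T: "T \<in> (\<lambda>(s, W). m s ` W) ` (S \<times> \<B>)" for T
    proof -
      obtain s W where s: "s \<in> topspace X" "W \<in> \<B>" "T = m s ` W"
        using T S(2) by blast
      then have "W \<subseteq> topspace X" "openin X W"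
        using assms(3) openin_subset by blast+
      then show ?thesis
        using s homeomorphic_map_openness_eq[OF homeomorphic_map_left_shift] by blast
    qed
    fix U x assume "openin X U \<and> x \<in> U"
    then have U: "openin X U" "x \<in> U" and x: "x \<in> topspace X"
      using openin_subset by blast+
    let ?P = "{p \<in> topspace (prod_topology X X). (\<lambda>(x, y). m x y) p \<in> U}"
    have "openin (prod_topology X X) ?P"
      using continuous_mult U(1) by (rule openin_continuous_map_preimage)
    moreover have "(x, e) \<in> ?P"
      using U x unit_closed right_unit by simp
    ultimately obtain O1 O2 where O: "openin X O1" "openin X O2" "x \<in> O1" "e \<in> O2" "O1 \<times> O2 \<subseteq> ?P"
      unfolding openin_prod_topology_alt by meson
    obtain W where W: "W \<in> \<B>" "e \<in> W" "W \<subseteq> O2"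
      using base[OF O(2,4)] by blast
    let ?Q = "{s \<in> topspace X. ldiv s x \<in> W}"
    have "continuous_map X (prod_topology X X) (\<lambda>s. (s, x))"
      using x by (intro continuous_map_pairedI) auto
    then have "continuous_map X X (\<lambda>s. ldiv s x)"
      using continuous_map_compose[OF _ continuous_div, of X "\<lambda>s. (s, x)"] by (simp add: o_def)
    then have "openin X ?Q"
      using assms(3)[OF W(1)] by (rule openin_continuous_map_preimage)
    then have "openin X (O1 \<inter> ?Q)"
      using O(1) by blast
    have "x \<in> O1 \<inter> ?Q"
      using O x W ldiv_self by simp
    obtain s where s: "s \<in> S" "s \<in> O1" "ldiv s x \<in> W"
    proof -
      have "x \<in> X closure_of S"
        using S(3) x by simp
      then obtain s where "s \<in> S" "s \<in> O1 \<inter> ?Q"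
        using \<open>openin X (O1 \<inter> ?Q)\<close> \<open>x \<in> O1 \<inter> ?Q\<close> unfolding in_closure_of by meson
      then show thesis
        using that by simp
    qed
    have "x \<in> m s ` W"
      using s S(2) x mult_ldiv by (metis imageI subsetD)
    moreover have "m s ` W \<subseteq> U"
    proof (rule image_subsetI)
      fix w assume "w \<in> W"
      then have "(s, w) \<in> ?P"
        using s(2) W(3) by (intro subsetD[OF O(5)]) auto
      then show "m s w \<in> U" by simp
    qed
    ultimately show "\<exists>V\<in>(\<lambda>(s, W). m s ` W) ` (S \<times> \<B>). x \<in> V \<and> V \<subseteq> U"
      using s(1) W(1) by blast
  qed
qed

end

theorem theorem4p16:
  fixes X :: "'a topology" and m :: "'a \<Rightarrow> 'a \<Rightarrow> 'a" and e :: 'a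
  assumes "topological_lop X m e"
    and "locally_narrow X m e"
    and "t0_space X"
  shows "P0_space X \<longleftrightarrow> metrizable_space X \<and> separable_space X"
proof
  interpret topological_lop X m e by fact
  assume "P0_space X"
  then obtain \<N> where reg: "regular_space X" "t1_space X"
    and \<N>: "countable \<N>" "\<And>x. x \<in> topspace X \<Longrightarrow> Pytkeev_network_at X \<N> x"
    unfolding P0_space_def Pytkeev_network_def by blast
  have sep: "separable_space X"
    using \<N> by (intro countable_network_imp_separable[of \<N>]) (auto simp: Pytkeev_network_at_def)
  obtain \<B> where "countable \<B>" "\<And>W. W \<in> \<B> \<Longrightarrow> openin X W"
    "\<And>U. openin X U \<Longrightarrow> e \<in> U \<Longrightarrow> \<exists>W\<in>\<B>. e \<in> W \<and> W \<subseteq> U"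
    using countable_base_at_unit[OF reg(1) sep assms(2) \<N>(1) \<N>(2)[OF unit_closed]] by metis
  then have "second_countable X"
    using sep by (rule_tac second_countable_if_base_at_unit)
  with reg sep show "metrizable_space X \<and> separable_space X"
    by (simp add: Urysohn_metrization)
next
  assume "metrizable_space X \<and> separable_space X"
  then show "P0_space X"
    unfolding P0_space_def
    using metrizable_imp_regular_space metrizable_imp_t1_space
      metrizable_separable_imp_second_countable second_countable_imp_countable_Pytkeev_network by blast
qed

end
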